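(* Consider a multi-stage robust optimization problem $$\min_{\boldsymbol{x}\in\mathcal{F}}\ \max_{\boldsymbol{\xi}\in\Psi}\ \boldsymbol{c}^\intercal\boldsymbol{x}(\boldsymbol{\xi})\quad\text{s.t.}\quad\boldsymbol{A}\boldsymbol{x}(\boldsymbol{\xi})\le\boldsymbol{b}(\boldsymbol{\xi})\ \ \forall\boldsymbol{\xi}\in\Psi,$$ written as an instance of $\mathcal{P}(\mathbb{P},\Xi)$ with $G=1$ and $\Xi_1=\Psi$ by means of an epigraphical variable. Then $\mathrm{Aff}\,\mathcal{P}'(\mathbb{P}',\overline{\Xi}')$ and $\mathrm{Aff}\,\mathcal{P}(\mathbb{P},\Xi)$ attain the same optimal value.
   Context: Notation: $[n]=\{1,\dots,n\}$. For a family of sets $\Xi=\{\Xi_g\}_{g\in[G]}$, the symbol $\Xi$ also denotes the union $\bigcup_g\Xi_g$ (similarly for the other families below). General problem. The uncertain parameters $\boldsymbol{\xi}=(\boldsymbol{\xi}_1,\dots,\boldsymbol{\xi}_T)\in\mathbb{R}^N$ are revealed over stages $t\in[T]$, and $\boldsymbol{\xi}^t=(\boldsymbol{\xi}_1,\dots,\boldsymbol{\xi}_t)$. They are governed by a probability distribution $\mathbb{P}$ supported on a family of compact sets $\Xi=\{\Xi_g\}_{g\in[G]}$. Problem $\mathcal{P}(\mathbb{P},\Xi)$ is $$\min_{\boldsymbol{x}\in\mathcal{F}}\ \mathbb{E}_{\mathbb{P}}[\boldsymbol{c}(\tilde{\boldsymbol{\xi}})^\intercal\boldsymbol{x}(\tilde{\boldsymbol{\xi}})]\quad\text{s.t.}\quad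 \boldsymbol{A}_g\boldsymbol{x}(\boldsymbol{\xi})\le\boldsymbol{b}_g(\boldsymbol{\xi})\ \ \forall g\in[G],\ \boldsymbol{\xi}\in\Xi_g,$$ with $\boldsymbol{A}_g$ fixed matrices and $\boldsymbol{c}(\cdot),\boldsymbol{b}_g(\cdot)$ affine. $\mathcal{F}$ is the set of non-anticipative decision rules $\boldsymbol{x}(\cdot)=(\boldsymbol{x}_0,\boldsymbol{x}_1(\cdot),\dots,\boldsymbol{x}_T(\cdot))$: $\boldsymbol{x}_0$ is constant and $\boldsymbol{x}_t$ depends on $\boldsymbol{\xi}$ only through $\boldsymbol{\xi}^t$. Robust problems as instances. In the robust problem, $\Psi\subseteq\mathbb{R}^N$ is compact, $\boldsymbol{c}$ is a fixed vector, $\boldsymbol{A}$ a fixed matrix, and $\boldsymbol{b}(\cdot)$ affine. It is the instance of $\mathcal{P}(\mathbb{P},\Xi)$ with $G=1$, $\Xi_1=\Psi$, $\mathbb{P}$ any distribution supported on $\Psi$, in which (i) the here-and-now decisions $\boldsymbol{x}_0$ are augmented by a scalar variable $\tau\in\mathbb{R}$, and the objective is to minimize $\tau$; and (ii) $(\boldsymbol{A}_1,\boldsymbol{b}_1)$ is $(\boldsymbol{A},\boldsymbol{b})$ augmented by the constraint $\boldsymbol{c}^\intercal\boldsymbol{x}(\boldsymbol{\xi})-\tau\le0$. Lifting. Matrices $\boldsymbol{E}_t$ define $\boldsymbol{\theta}_t=\boldsymbol{E}_t\boldsymbol{\xi}^t$; for each $t$ the linear map $\boldsymbol{E}^t:\boldsymbol{\xi}^t\mapsto\boldsymbol{\theta}^t=(\boldsymbol{\theta}_1,\dots,\boldsymbol{\theta}_t)$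 is injective. Put $\boldsymbol{E}=\boldsymbol{E}^T$, $\Theta_g=\boldsymbol{E}\Xi_g\subseteq\mathbb{R}^I$, $\Theta=\bigcup_g\Theta_g$. For each $i\in[I]$ let $\underline{\theta}_i=\min_{\boldsymbol\theta\in\Theta}\theta_i$, $\overline{\theta}_i=\max_{\boldsymbol\theta\in\Theta}\theta_i$ and choose $\underline{\theta}_i=z_{i0}<z_{i1}<\dots<z_{iJ_i}=\overline{\theta}_i$. The folding operator $F$ has components, for $i\in[I],j\in[J_i]$: $F_{ij}(\theta_i)=0$ if $\theta_i<z_{i,j-1}$; $F_{ij}(\theta_i)=\theta_i-z_{i,j-1}$ if $\theta_i\in[z_{i,j-1},z_{ij}]$; $F_{ij}(\theta_i)=z_{ij}-z_{i,j-1}$ if $\theta_i>z_{ij}$. Lifted vectors $\boldsymbol{\xi}'\in\mathbb{R}^{N'}$, $N'=\sum_iJ_i$, have components $\xi'_{ij}$. The left-inverses are $\boldsymbol{E}^+=(\boldsymbol{E}^\intercal\boldsymbol{E})^{-1}\boldsymbol{E}^\intercal$ and $F^+$ with $F^+_i(\boldsymbol{\xi}')=\underline{\theta}_i+\sum_{j\in[J_i]}\xi'_{ij}$. Set $L=F\circ\boldsymbol{E}$, $R=\boldsymbol{E}^+\circ F^+$, $\Xi'_g=L(\Xi_g)$, and let $\mathbb{P}'$ be the push-forward of $\mathbb{P}$ under $L$. For a family $S=\{S_g\}_{g\in[G]}$ of subsets of $\mathbb{R}^{N'}$, $\mathcal{P}'(\mathbb{P}',S)$ is $$\min_{\boldsymbol{x}'\in\mathcal{F}'}\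 \mathbb{E}_{\mathbb{P}'}[\boldsymbol{c}(R(\tilde{\boldsymbol{\xi}}'))^\intercal\boldsymbol{x}'(\tilde{\boldsymbol{\xi}}')]\quad\text{s.t.}\quad\boldsymbol{A}_g\boldsymbol{x}'(\boldsymbol{\xi}')\le\boldsymbol{b}_g(R(\boldsymbol{\xi}'))\ \ \forall g\in[G],\ \boldsymbol{\xi}'\in S_g,$$ where $\mathcal{F}'$ encodes non-anticipativity in the lifted space ($\boldsymbol{x}'_0$ is constant; $\boldsymbol{x}'_t$ depends only on the components $\xi'_{ij}$ for which $\theta_i$ is a component of $\boldsymbol{\theta}^t$). $\mathrm{Aff}\,\mathcal{P}$ and $\mathrm{Aff}\,\mathcal{P}'$ denote the same problems with decision rules additionally restricted to be affine. Outer approximation. Let $[\underline{\boldsymbol\theta}_g,\overline{\boldsymbol\theta}_g]$ be the smallest hyperrectangle containing $\Theta_g$. Then $\overline{\Xi}'=\{\overline{\Xi}'_g\}_{g\in[G]}$ with $$\overline{\Xi}'_g=\{\boldsymbol{\xi}'\in\mathbb{R}^{N'}: F^+(\boldsymbol{\xi}')\in\Theta_g\}\cap\mathrm{conv}\big(F([\underline{\boldsymbol\theta}_g,\overline{\boldsymbol\theta}_g])\big).$$ *)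

theory Defs
  imports "HOL-Probability.Probability"
begin

(* Dimensions are index types. The division of a vector into stage blocks is given by a
   function sending each coordinate to its stage, so v^t = (v_1, ..., v_t) consists of the
   coordinates of stage at most t. *)

definition agree_upto :: "('a::finite \<Rightarrow> nat) \<Rightarrow> nat \<Rightarrow> real^'a \<Rightarrow> real^'a \<Rightarrow> bool" where
  "agree_upto st t u v \<longleftrightarrow> (\<forall>i. st i \<le> t \<longrightarrow> u $ i = v $ i)"

definition affine_map :: "('a::real_vector \<Rightarrow> 'b::real_vector) \<Rightarrow> bool" where
  "affine_map f \<longleftrightarrow> (\<exists>h d. linear h \<and> (\<forall>x. f x = h x + d))"

definition lower_corner :: "(real^'i) set \<Rightarrow> real^'i" where
  "lower_corner S = (\<chi> i. INF \<theta>\<in>S. \<theta> $ i)"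

definition upper_corner :: "(real^'i) set \<Rightarrow> real^'i" where
  "upper_corner S = (\<chi> i. SUP \<theta>\<in>S. \<theta> $ i)"


(* The data of P(Prob, Xi), for g in {1..num_sets}. Uncertain parameters have stages in
   {1..horizon}; decisions have stages in {0..horizon}, stage 0 being here-and-now. *)

record ('n, 'd, 'm) problem =
  horizon :: nat
  obs_stage :: "'n \<Rightarrow> nat"
  dec_stage :: "'d \<Rightarrow> nat"
  num_sets :: nat
  Xi :: "nat \<Rightarrow> (real^'n) set"
  Prob :: "(real^'n) measure"
  cost :: "real^'n \<Rightarrow> real^'d"
  Amat :: "nat \<Rightarrow> real^'d^'m"
  rhs :: "nat \<Rightarrow> real^'n \<Rightarrow> real^'m"

definition rules ::
  "('n::finite, 'd::finite, 'm::finite) problem \<Rightarrow> (real^'n \<Rightarrow> real^'d) set" where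
  "rules P = {x. \<forall>k \<xi> \<eta>. agree_upto (obs_stage P) (dec_stage P k) \<xi> \<eta> \<longrightarrow> x \<xi> $ k = x \<eta> $ k}"

definition aff_feasible ::
  "('n::finite, 'd::finite, 'm::finite) problem \<Rightarrow> (real^'n \<Rightarrow> real^'d) set" where
  "aff_feasible P = {x \<in> rules P. affine_map x \<and>
     (\<forall>g\<in>{1..num_sets P}. \<forall>\<xi>\<in>Xi P g. Amat P g *v x \<xi> \<le> rhs P g \<xi>)}"

definition objective ::
  "('n::finite, 'd::finite, 'm::finite) problem \<Rightarrow> (real^'n \<Rightarrow> real^'d) \<Rightarrow> real" where
  "objective P x = (\<integral>\<xi>. cost P \<xi> \<bullet> x \<xi> \<partial>Prob P)"

(* Infeasible problems have value infinity, unbounded ones minus infinity. *)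

definition aff_value :: "('n::finite, 'd::finite, 'm::finite) problem \<Rightarrow> ereal" where
  "aff_value P = (INF x\<in>aff_feasible P. ereal (objective P x))"


(* Coordinate (i, j) of the lifted space, for j in {1..pieces i}, is coordinate "slot i j" of
   real^'k. For injective slot this identifies R^N' with a coordinate subspace of real^'k, all
   of it unless there are spare coordinates. Spare coordinates are 0 in every folded vector
   and invisible to lifted decision rules; they admit the case N' = 0 (Theta a singleton). *)

record ('n, 'i, 'k) lifting =
  Emat :: "real^'n^'i"
  theta_stage :: "'i \<Rightarrow> nat"
  pieces :: "'i \<Rightarrow> nat"
  breakpoint :: "'i \<Rightarrow> nat \<Rightarrow> real"
  slot :: "'i \<Rightarrow> nat \<Rightarrow> 'k"

definition Theta ::
  "('n::finite, 'd::finite, 'm::finite) problem \<Rightarrow> ('n, 'i::finite, 'k::finite) lifting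
    \<Rightarrow> nat \<Rightarrow> (real^'i) set" where
  "Theta P \<Lambda> g = (\<lambda>\<xi>. Emat \<Lambda> *v \<xi>) ` Xi P g"

definition Theta_all ::
  "('n::finite, 'd::finite, 'm::finite) problem \<Rightarrow> ('n, 'i::finite, 'k::finite) lifting
    \<Rightarrow> (real^'i) set" where
  "Theta_all P \<Lambda> = (\<Union>g\<in>{1..num_sets P}. Theta P \<Lambda> g)"

(* The second conjunct says that theta_t = E_t xi^t, the third that the map xi^t |-> theta^t
   is injective for each t. *)

definition valid_lifting ::
  "('n::finite, 'd::finite, 'm::finite) problem \<Rightarrow> ('n, 'i::finite, 'k::finite) lifting
    \<Rightarrow> bool" where
  "valid_lifting P \<Lambda> \<longleftrightarrow>
     range (theta_stage \<Lambda>) \<subseteq> {1..horizon P} \<and>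
     (\<forall>i n. theta_stage \<Lambda> i < obs_stage P n \<longrightarrow> Emat \<Lambda> $ i $ n = 0) \<and>
     (\<forall>t\<in>{1..horizon P}. \<forall>\<xi> \<eta>.
        agree_upto (theta_stage \<Lambda>) t (Emat \<Lambda> *v \<xi>) (Emat \<Lambda> *v \<eta>) \<longrightarrow>
        agree_upto (obs_stage P) t \<xi> \<eta>) \<and>
     (\<forall>i. breakpoint \<Lambda> i 0 = lower_corner (Theta_all P \<Lambda>) $ i \<and>
          breakpoint \<Lambda> i (pieces \<Lambda> i) = upper_corner (Theta_all P \<Lambda>) $ i \<and>
          (\<forall>j\<in>{1..pieces \<Lambda> i}. breakpoint \<Lambda> i (j - 1) < breakpoint \<Lambda> i j)) \<and>
     inj_on (\<lambda>(i, j). slot \<Lambda> i j) (SIGMA i:UNIV. {1..pieces \<Lambda> i})"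

definition fold_component :: "real \<Rightarrow> real \<Rightarrow> real \<Rightarrow> real" where
  "fold_component l u s = (if s < l then 0 else if s \<le> u then s - l else u - l)"

definition folding ::
  "('n::finite, 'i::finite, 'k::finite) lifting \<Rightarrow> real^'i \<Rightarrow> real^'k" where
  "folding \<Lambda> \<theta> = (\<Sum>i\<in>UNIV. \<Sum>j = 1..pieces \<Lambda> i.
     axis (slot \<Lambda> i j) (fold_component (breakpoint \<Lambda> i (j - 1)) (breakpoint \<Lambda> i j) (\<theta> $ i)))"

definition unfolding_map ::
  "('n::finite, 'd::finite, 'm::finite) problem \<Rightarrow> ('n, 'i::finite, 'k::finite) lifting
    \<Rightarrow> real^'k \<Rightarrow> real^'i" where
  "unfolding_map P \<Lambda> \<zeta> =
     (\<chi> i. lower_corner (Theta_all P \<Lambda>) $ i + (\<Sum>j = 1..pieces \<Lambda> i. \<zeta> $ slot \<Lambda> i j))"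

definition lift ::
  "('n::finite, 'i::finite, 'k::finite) lifting \<Rightarrow> real^'n \<Rightarrow> real^'k" where
  "lift \<Lambda> \<xi> = folding \<Lambda> (Emat \<Lambda> *v \<xi>)"

definition pseudo_inverse :: "real^'n^'i \<Rightarrow> real^'i^'n" where
  "pseudo_inverse E = matrix_inv (transpose E ** E) ** transpose E"

definition retract ::
  "('n::finite, 'd::finite, 'm::finite) problem \<Rightarrow> ('n, 'i::finite, 'k::finite) lifting
    \<Rightarrow> real^'k \<Rightarrow> real^'n" where
  "retract P \<Lambda> \<zeta> = pseudo_inverse (Emat \<Lambda>) *v unfolding_map P \<Lambda> \<zeta>"

definition lifted_Prob ::
  "('n::finite, 'd::finite, 'm::finite) problem \<Rightarrow> ('n, 'i::finite, 'k::finite) lifting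
    \<Rightarrow> (real^'k) measure" where
  "lifted_Prob P \<Lambda> = distr (Prob P) borel (lift \<Lambda>)"

definition lifted_rules ::
  "('n::finite, 'd::finite, 'm::finite) problem \<Rightarrow> ('n, 'i::finite, 'k::finite) lifting
    \<Rightarrow> (real^'k \<Rightarrow> real^'d) set" where
  "lifted_rules P \<Lambda> = {x. \<forall>k \<zeta> \<eta>.
     (\<forall>i. theta_stage \<Lambda> i \<le> dec_stage P k \<longrightarrow>
        (\<forall>j\<in>{1..pieces \<Lambda> i}. \<zeta> $ slot \<Lambda> i j = \<eta> $ slot \<Lambda> i j)) \<longrightarrow>
     x \<zeta> $ k = x \<eta> $ k}"

definition lifted_aff_feasible ::
  "('n::finite, 'd::finite, 'm::finite) problem \<Rightarrow> ('n, 'i::finite, 'k::finite) lifting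
    \<Rightarrow> (nat \<Rightarrow> (real^'k) set) \<Rightarrow> (real^'k \<Rightarrow> real^'d) set" where
  "lifted_aff_feasible P \<Lambda> S = {x \<in> lifted_rules P \<Lambda>. affine_map x \<and>
     (\<forall>g\<in>{1..num_sets P}. \<forall>\<zeta>\<in>S g. Amat P g *v x \<zeta> \<le> rhs P g (retract P \<Lambda> \<zeta>))}"

definition lifted_objective ::
  "('n::finite, 'd::finite, 'm::finite) problem \<Rightarrow> ('n, 'i::finite, 'k::finite) lifting
    \<Rightarrow> (real^'k \<Rightarrow> real^'d) \<Rightarrow> real" where
  "lifted_objective P \<Lambda> x = (\<integral>\<zeta>. cost P (retract P \<Lambda> \<zeta>) \<bullet> x \<zeta> \<partial>lifted_Prob P \<Lambda>)"

definition lifted_aff_value ::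
  "('n::finite, 'd::finite, 'm::finite) problem \<Rightarrow> ('n, 'i::finite, 'k::finite) lifting
    \<Rightarrow> (nat \<Rightarrow> (real^'k) set) \<Rightarrow> ereal" where
  "lifted_aff_value P \<Lambda> S = (INF x\<in>lifted_aff_feasible P \<Lambda> S. ereal (lifted_objective P \<Lambda> x))"

definition outer_approx ::
  "('n::finite, 'd::finite, 'm::finite) problem \<Rightarrow> ('n, 'i::finite, 'k::finite) lifting
    \<Rightarrow> nat \<Rightarrow> (real^'k) set" where
  "outer_approx P \<Lambda> g = {\<zeta>. unfolding_map P \<Lambda> \<zeta> \<in> Theta P \<Lambda> g} \<inter>
     convex hull (folding \<Lambda> `
       cbox (lower_corner (Theta P \<Lambda> g)) (upper_corner (Theta P \<Lambda> g)))"


(* Decision None is the epigraphical variable tau and row None is c . x(xi) - tau <= 0. *)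

definition robust_instance ::
  "nat \<Rightarrow> ('n::finite \<Rightarrow> nat) \<Rightarrow> ('d::finite \<Rightarrow> nat) \<Rightarrow> (real^'n) set \<Rightarrow> (real^'n) measure
    \<Rightarrow> real^'d \<Rightarrow> real^'d^'m::finite \<Rightarrow> (real^'n \<Rightarrow> real^'m)
    \<Rightarrow> ('n, 'd option, 'm option) problem" where
  "robust_instance T \<sigma> \<rho> \<Psi> M c A b =
     \<lparr> horizon = T,
       obs_stage = \<sigma>,
       dec_stage = (\<lambda>k. case k of None \<Rightarrow> 0 | Some d \<Rightarrow> \<rho> d),
       num_sets = 1,
       Xi = (\<lambda>g. \<Psi>),
       Prob = M,
       cost = (\<lambda>\<xi>. axis None 1),
       Amat = (\<lambda>g. \<chi> r k. case r of
           None \<Rightarrow> (case k of None \<Rightarrow> - 1 | Some d \<Rightarrow> c $ d)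
         | Some m \<Rightarrow> (case k of None \<Rightarrow> 0 | Some d \<Rightarrow> A $ m $ d)),
       rhs = (\<lambda>g \<xi>. \<chi> r. case r of None \<Rightarrow> 0 | Some m \<Rightarrow> b \<xi> $ m) \<rparr>"

end

theory Submission
  imports Defs
begin

text \<open>
  The objective of a robust instance is the here-and-now epigraphical variable alone, so every
  probability distribution assigns a decision rule the same cost, namely that constant. It
  therefore suffices to turn affine rules of either problem into affine rules of the other that
  have the same here-and-now part.

  From original to lifted rules, one composes with a left inverse of the lifting. The
  pseudo-inverse \<open>E\<^sup>+\<close> will not do: off the range of \<open>E\<close> an early component of \<open>E\<^sup>+ \<theta>\<close> may depend on
  late components of \<open>\<theta>\<close>, so the composition could be anticipative. The injectivity of every
  truncated map \<open>E\<^sup>t\<close> yields another linear left inverse that respects the stages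
  (\<open>nonanticipative_left_inverse\<close>). On the outer approximation both left inverses agree, because
  there \<open>F\<^sup>+\<close> takes values in \<open>\<Theta>\<close>.

  From lifted to original rules, one needs an affine way to choose a point of the outer
  approximation above each \<open>\<xi>\<close>. The lifting \<open>L\<close> itself is only piecewise affine. But the affine
  map that agrees with \<open>F\<close> at the vertices of the bounding box maps the whole box into the convex
  hull of the folded vertices (\<open>chord_in_convex_hull_folding\<close>), and \<open>F\<^sup>+\<close> inverts it
  (\<open>unfolding_chord\<close>). This works because there is a single set \<open>\<Theta>\<^sub>1\<close>, whose box is spanned by
  the outermost breakpoints. With several sets, each \<open>\<Theta>\<^sub>g\<close> has a box and a chord of its own, and
  no single affine map need fit them all.

  Hence the two problems have the same set of attainable objective values, which gives
  equality of the infima and of the statements that they are attained.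
\<close>

section \<open>Affine maps and linear left inverses\<close>

lemma affine_map_compose:
  assumes "affine_map f" and "affine_map g"
  shows "affine_map (\<lambda>x. f (g x))"
proof -
  obtain h d where h: "linear h" "\<And>x. f x = h x + d"
    using assms(1) unfolding affine_map_def by blast
  obtain k e where k: "linear k" "\<And>x. g x = k x + e"
    using assms(2) unfolding affine_map_def by blast
  have "linear (\<lambda>x. h (k x))"
    using linear_compose[OF k(1) h(1)] by (simp add: o_def)
  moreover have "f (g x) = h (k x) + (h e + d)" for x
    by (simp add: h k linear_add[OF h(1)])
  ultimately show ?thesis
    unfolding affine_map_def by blast
qed

lemma linear_imp_affine_map: "linear f \<Longrightarrow> affine_map f"
  unfolding affine_map_def by (intro exI[of _ f] exI[of _ 0]) simp

lemma linear_factor_through: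
  fixes f :: "'a::real_vector \<Rightarrow> 'b::real_vector" and \<phi> :: "'a \<Rightarrow> 'c::real_vector"
  assumes f: "linear f" and \<phi>: "linear \<phi>" and ker: "\<And>x. f x = 0 \<Longrightarrow> \<phi> x = 0"
  obtains g where "linear g" and "\<And>x. g (f x) = \<phi> x"
proof -
  obtain h where h: "linear h" "\<And>y. y \<in> range f \<Longrightarrow> f (h y) = y"
    using linear_exists_right_inverse_on[OF f, of UNIV] by auto
  have "\<phi> (h (f x)) = \<phi> x" for x
    using ker[of "h (f x) - x"] h(2)[of "f x"] by (simp add: linear_diff[OF f] linear_diff[OF \<phi>])
  moreover have "linear (\<lambda>y. \<phi> (h y))"
    using linear_compose[OF h(1) \<phi>] by (simp add: o_def)
  ultimately show ?thesis
    using that by blast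
qed

lemma pseudo_inverse_left_inverse:
  fixes E :: "real^'n^'i"
  assumes "inj ((*v) E)"
  shows "pseudo_inverse E *v (E *v \<xi>) = \<xi>"
proof -
  let ?B = "transpose E ** E"
  have "x = 0" if "?B *v x = 0" for x
  proof -
    have "(E *v x) \<bullet> (E *v x) = (?B *v x) \<bullet> x"
      by (metis dot_lmul_matrix matrix_vector_mul_assoc transpose_matrix_vector)
    then have "E *v x = E *v 0"
      using that by simp
    then show ?thesis
      by (rule injD[OF assms])
  qed
  then have "invertible ?B"
    by (metis invertible_left_inverse matrix_left_invertible_ker)
  then have "matrix_inv ?B ** ?B = mat 1"
    unfolding matrix_inv_def invertible_def by (rule someI2_ex) blast
  then show ?thesis
    by (simp add: pseudo_inverse_def matrix_vector_mul_assoc matrix_mul_assoc)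
qed

lemma inj_Emat:
  assumes "valid_lifting P \<Lambda>" and "range (obs_stage P) \<subseteq> {1..horizon P}"
  shows "inj ((*v) (Emat \<Lambda>))"
proof (rule injI)
  fix \<xi> \<eta>
  assume eq: "Emat \<Lambda> *v \<xi> = Emat \<Lambda> *v \<eta>"
  have stages: "obs_stage P n \<in> {1..horizon P}" for n
    using assms(2) by blast
  have "horizon P \<in> {1..horizon P}"
    using stages[of undefined] by simp
  then have "agree_upto (obs_stage P) (horizon P) \<xi> \<eta>"
    using assms(1) eq unfolding valid_lifting_def agree_upto_def by metis
  then show "\<xi> = \<eta>"
    using stages by (simp add: agree_upto_def vec_eq_iff)
qed

text \<open>
  A component \<open>\<xi>\<^sub>n\<close> of stage \<open>t\<close> vanishes whenever \<open>\<theta>\<^sup>t = E\<^sup>t \<xi>\<^sup>t\<close> does, so it is a linear function of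
  \<open>\<theta>\<^sup>t\<close> alone. Choosing such a function for every component separately makes the left inverse
  non-anticipative on the whole space and not just on the range of \<open>E\<close>.
\<close>

lemma nonanticipative_left_inverse:
  fixes P :: "('n::finite, 'd::finite, 'm::finite) problem"
    and \<Lambda> :: "('n, 'i::finite, 'k::finite) lifting"
  assumes valid: "valid_lifting P \<Lambda>" and stages: "range (obs_stage P) \<subseteq> {1..horizon P}"
  obtains H where "linear H" and "\<And>\<xi>. H (Emat \<Lambda> *v \<xi>) = \<xi>"
    and "\<And>t \<theta> \<eta>. agree_upto (theta_stage \<Lambda>) t \<theta> \<eta> \<Longrightarrow> agree_upto (obs_stage P) t (H \<theta>) (H \<eta>)"
proof -
  define trunc :: "nat \<Rightarrow> real^'i \<Rightarrow> real^'i"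
    where "trunc t \<theta> = (\<chi> i. if theta_stage \<Lambda> i \<le> t then \<theta> $ i else 0)" for t \<theta>
  have lin_trunc: "linear (trunc t)" for t
    by (rule linearI) (auto simp: trunc_def vec_eq_iff)
  have "\<exists>g. linear g \<and> (\<forall>\<xi>. g (trunc (obs_stage P n) (Emat \<Lambda> *v \<xi>)) = \<xi> $ n)" for n
  proof -
    let ?t = "obs_stage P n"
    have "linear (\<lambda>\<xi>. trunc ?t (Emat \<Lambda> *v \<xi>))"
      using linear_compose[OF matrix_vector_mul_linear lin_trunc] by (simp add: o_def)
    moreover have "linear (\<lambda>\<xi>::real^'n. \<xi> $ n)"
      by (rule linearI) auto
    moreover have "\<xi> $ n = 0" if "trunc ?t (Emat \<Lambda> *v \<xi>) = 0" for \<xi>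
    proof -
      have "agree_upto (theta_stage \<Lambda>) ?t (Emat \<Lambda> *v \<xi>) (Emat \<Lambda> *v 0)"
        using that by (auto simp: agree_upto_def trunc_def vec_eq_iff split: if_splits)
      moreover have "?t \<in> {1..horizon P}"
        using stages by blast
      ultimately have "agree_upto (obs_stage P) ?t \<xi> 0"
        using valid unfolding valid_lifting_def by blast
      then show ?thesis
        by (simp add: agree_upto_def)
    qed
    ultimately show ?thesis
      by (rule linear_factor_through) blast+
  qed
  then obtain g where g: "\<And>n. linear (g n)"
      "\<And>n \<xi>. g n (trunc (obs_stage P n) (Emat \<Lambda> *v \<xi>)) = \<xi> $ n"
    by metis
  define H where "H \<theta> = (\<chi> n. g n (trunc (obs_stage P n) \<theta>))" for \<theta>
  show ?thesis
  proof (rule that)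
    show "linear H"
      by (rule linearI)
        (auto simp: H_def vec_eq_iff linear_add[OF lin_trunc] linear_add[OF g(1)]
          linear_cmul[OF lin_trunc] linear_cmul[OF g(1)])
    show "H (Emat \<Lambda> *v \<xi>) = \<xi>" for \<xi>
      by (simp add: H_def g vec_eq_iff)
    show "agree_upto (obs_stage P) t (H \<theta>) (H \<eta>)"
      if "agree_upto (theta_stage \<Lambda>) t \<theta> \<eta>" for t \<theta> \<eta>
    proof -
      have "trunc (obs_stage P n) \<theta> = trunc (obs_stage P n) \<eta>" if "obs_stage P n \<le> t" for n
        using \<open>agree_upto (theta_stage \<Lambda>) t \<theta> \<eta>\<close> that
        by (auto simp: agree_upto_def trunc_def vec_eq_iff)
      then show ?thesis
        by (simp add: agree_upto_def H_def)
    qed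
  qed
qed

section \<open>Folding along the chord of the bounding box\<close>

lemma breakpoint_mono:
  assumes "valid_lifting P \<Lambda>" and "a \<le> b" and "b \<le> pieces \<Lambda> i"
  shows "breakpoint \<Lambda> i a \<le> breakpoint \<Lambda> i b"
  using assms(2,3)
proof (induction b rule: dec_induct)
  case (step m)
  have "breakpoint \<Lambda> i (Suc m - 1) < breakpoint \<Lambda> i (Suc m)"
    using assms(1) step unfolding valid_lifting_def by (metis atLeastAtMost_iff le_add1 plus_1_eq_Suc)
  then show ?case
    using step by simp
qed simp

lemma breakpoint_less:
  assumes "valid_lifting P \<Lambda>" and "j \<in> {1..pieces \<Lambda> i}"
  shows "breakpoint \<Lambda> i (j - 1) < breakpoint \<Lambda> i j"
  using assms unfolding valid_lifting_def by blast

lemma fold_component_eq: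
  "l < u \<Longrightarrow> fold_component l u s = min (max s l) u - l"
  by (auto simp: fold_component_def)

text \<open>
  The folded image of the box point with relative coordinates \<open>w \<in> [0, 1]\<^sup>I\<close> if each coordinate of
  the box is folded as if it had no breakpoints: all pieces fill up at the same relative rate.
\<close>

definition chord ::
  "('n::finite, 'i::finite, 'k::finite) lifting \<Rightarrow> real^'i \<Rightarrow> real^'k" where
  "chord \<Lambda> w = (\<Sum>i\<in>UNIV. \<Sum>j = 1..pieces \<Lambda> i.
     axis (slot \<Lambda> i j) (w $ i * (breakpoint \<Lambda> i j - breakpoint \<Lambda> i (j - 1))))"

lemma linear_chord:
  fixes \<Lambda> :: "('n::finite, 'i::finite, 'k::finite) lifting"
  shows "linear (chord \<Lambda>)"
proof -
  have "linear (\<lambda>w. axis s (w $ i * r) :: real^'k)" for s and i :: 'i and r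
    by (rule linearI) (auto simp: axis_def vec_eq_iff algebra_simps)
  then show ?thesis
    unfolding chord_def by (intro linear_compose_sum ballI)
qed

lemma chord_nth:
  assumes "valid_lifting P \<Lambda>" and j: "j \<in> {1..pieces \<Lambda> i}"
  shows "chord \<Lambda> w $ slot \<Lambda> i j = w $ i * (breakpoint \<Lambda> i j - breakpoint \<Lambda> i (j - 1))"
proof -
  let ?a = "\<lambda>i j. w $ i * (breakpoint \<Lambda> i j - breakpoint \<Lambda> i (j - 1))"
  have "inj_on (\<lambda>(i, j). slot \<Lambda> i j) (SIGMA i:UNIV. {1..pieces \<Lambda> i})"
    using assms(1) unfolding valid_lifting_def by blast
  then have slot_eq: "slot \<Lambda> i j = slot \<Lambda> p q \<longleftrightarrow> p = i \<and> q = j" if "q \<in> {1..pieces \<Lambda> p}" for p q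
    using inj_on_eq_iff[of "\<lambda>(i, j). slot \<Lambda> i j" "SIGMA i:UNIV. {1..pieces \<Lambda> i}" "(i, j)" "(p, q)"]
      j that by auto
  have "chord \<Lambda> w $ slot \<Lambda> i j = (\<Sum>p\<in>UNIV. \<Sum>q = 1..pieces \<Lambda> p.
      if p = i \<and> q = j then ?a p q else 0)"
    unfolding chord_def sum_component axis_def
    by (intro sum.cong refl) (auto simp: slot_eq)
  also have "\<dots> = (\<Sum>p\<in>UNIV. if p = i then ?a i j else 0)"
    using j by (intro sum.cong refl) (auto simp: sum.delta)
  finally show ?thesis
    by simp
qed

lemma unfolding_chord:
  assumes "valid_lifting P \<Lambda>"
  shows "unfolding_map P \<Lambda> (chord \<Lambda> w) = (\<chi> i. lower_corner (Theta_all P \<Lambda>) $ i +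
    w $ i * (upper_corner (Theta_all P \<Lambda>) $ i - lower_corner (Theta_all P \<Lambda>) $ i))"
proof -
  have "(\<Sum>j = 1..pieces \<Lambda> i. chord \<Lambda> w $ slot \<Lambda> i j) =
      w $ i * (breakpoint \<Lambda> i (pieces \<Lambda> i) - breakpoint \<Lambda> i 0)" for i
  proof -
    have "(\<Sum>j = 1..pieces \<Lambda> i. chord \<Lambda> w $ slot \<Lambda> i j) =
        (\<Sum>j = 1..pieces \<Lambda> i. w $ i * (breakpoint \<Lambda> i j - breakpoint \<Lambda> i (j - 1)))"
      by (intro sum.cong refl chord_nth[OF assms])
    also have "\<dots> = w $ i * (\<Sum>j = 1..pieces \<Lambda> i. breakpoint \<Lambda> i j - breakpoint \<Lambda> i (j - 1))"
      by (simp add: sum_distrib_left)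
    also have "(\<Sum>j = 1..pieces \<Lambda> i. breakpoint \<Lambda> i j - breakpoint \<Lambda> i (j - 1)) =
        breakpoint \<Lambda> i (pieces \<Lambda> i) - breakpoint \<Lambda> i 0"
      using sum_telescope''[of 0 "pieces \<Lambda> i" "breakpoint \<Lambda> i"]
      by (simp add: atLeastSucAtMost_greaterThanAtMost)
    finally show ?thesis .
  qed
  moreover have "breakpoint \<Lambda> i 0 = lower_corner (Theta_all P \<Lambda>) $ i"
      "breakpoint \<Lambda> i (pieces \<Lambda> i) = upper_corner (Theta_all P \<Lambda>) $ i" for i
    using assms unfolding valid_lifting_def by blast+
  ultimately show ?thesis
    by (simp add: unfolding_map_def)
qed

text \<open>
  At a vertex of the box each piece is either empty or full, so there the chord agrees with the
  folding operator. The chord is linear and the unit cube is the convex hull of its vertices.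
\<close>

lemma chord_in_convex_hull_folding:
  fixes P :: "('n::finite, 'd::finite, 'm::finite) problem"
    and \<Lambda> :: "('n, 'i::finite, 'k::finite) lifting"
  assumes valid: "valid_lifting P \<Lambda>" and w: "w \<in> cbox 0 One"
    and le: "\<And>i. lower_corner (Theta_all P \<Lambda>) $ i \<le> upper_corner (Theta_all P \<Lambda>) $ i"
  shows "chord \<Lambda> w \<in> convex hull (folding \<Lambda> `
    cbox (lower_corner (Theta_all P \<Lambda>)) (upper_corner (Theta_all P \<Lambda>)))"
    (is "_ \<in> convex hull (_ ` cbox ?l ?u)")
proof -
  let ?V = "{v :: real^'i. \<forall>i\<in>Basis. v \<bullet> i = 0 \<or> v \<bullet> i = 1}"
  have "chord \<Lambda> v \<in> folding \<Lambda> ` cbox ?l ?u" if "v \<in> ?V" for v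
  proof -
    have v: "v $ i = 0 \<or> v $ i = 1" for i
      using that by (force simp: Basis_vec_def inner_axis)
    define \<theta> where "\<theta> = (\<chi> i. if v $ i = 0 then ?l $ i else ?u $ i)"
    have "fold_component (breakpoint \<Lambda> i (j - 1)) (breakpoint \<Lambda> i j) (\<theta> $ i) =
        v $ i * (breakpoint \<Lambda> i j - breakpoint \<Lambda> i (j - 1))" if j: "j \<in> {1..pieces \<Lambda> i}" for i j
    proof -
      have "breakpoint \<Lambda> i 0 \<le> breakpoint \<Lambda> i (j - 1)"
          "breakpoint \<Lambda> i j \<le> breakpoint \<Lambda> i (pieces \<Lambda> i)"
        using breakpoint_mono[OF valid] j by auto
      moreover have "breakpoint \<Lambda> i 0 = ?l $ i" "breakpoint \<Lambda> i (pieces \<Lambda> i) = ?u $ i"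
        using valid unfolding valid_lifting_def by blast+
      ultimately show ?thesis
        using v[of i] breakpoint_less[OF valid j] by (auto simp: fold_component_eq \<theta>_def)
    qed
    then have "chord \<Lambda> v = folding \<Lambda> \<theta>"
      unfolding chord_def folding_def by (intro sum.cong refl) simp
    moreover have "\<theta> \<in> cbox ?l ?u"
      by (simp add: mem_box_cart \<theta>_def le)
    ultimately show ?thesis
      by blast
  qed
  then have "convex hull (chord \<Lambda> ` ?V) \<subseteq> convex hull (folding \<Lambda> ` cbox ?l ?u)"
    by (intro hull_mono) blast
  moreover have "chord \<Lambda> w \<in> chord \<Lambda> ` (convex hull ?V)"
    using w by (simp add: unit_interval_convex_hull)
  ultimately show ?thesis
    by (simp add: convex_hull_linear_image[OF linear_chord]) blast
qed

lemma compact_imp_between_corners: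
  fixes S :: "(real^'i) set"
  assumes "compact S" and "\<theta> \<in> S"
  shows "lower_corner S $ i \<le> \<theta> $ i" and "\<theta> $ i \<le> upper_corner S $ i"
proof -
  have "compact ((\<lambda>\<theta>. \<theta> $ i) ` S)"
    using assms(1) by (intro compact_continuous_image continuous_intros)
  then have "bdd_below ((\<lambda>\<theta>. \<theta> $ i) ` S)" "bdd_above ((\<lambda>\<theta>. \<theta> $ i) ` S)"
    by (simp_all add: compact_imp_bounded bounded_imp_bdd_below bounded_imp_bdd_above)
  then show "lower_corner S $ i \<le> \<theta> $ i" "\<theta> $ i \<le> upper_corner S $ i"
    using assms(2) by (auto simp: lower_corner_def upper_corner_def intro: cINF_lower cSUP_upper)
qed

section \<open>Transfer of affine decision rules\<close>

lemma affine_map_unfolding: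
  fixes \<Lambda> :: "('n::finite, 'i::finite, 'k::finite) lifting"
  shows "affine_map (unfolding_map P \<Lambda>)"
proof -
  have "linear (\<lambda>\<zeta>::real^'k. \<chi> i. \<Sum>j = 1..pieces \<Lambda> i. \<zeta> $ slot \<Lambda> i j)"
    by (rule linearI) (auto simp: vec_eq_iff sum.distrib sum_distrib_left)
  moreover have "unfolding_map P \<Lambda> \<zeta> =
      (\<chi> i. \<Sum>j = 1..pieces \<Lambda> i. \<zeta> $ slot \<Lambda> i j) + lower_corner (Theta_all P \<Lambda>)" for \<zeta>
    by (simp add: unfolding_map_def vec_eq_iff)
  ultimately show ?thesis
    unfolding affine_map_def by blast
qed

lemma retract_eq:
  assumes "valid_lifting P \<Lambda>" and "range (obs_stage P) \<subseteq> {1..horizon P}"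
    and "unfolding_map P \<Lambda> \<zeta> = Emat \<Lambda> *v \<xi>"
  shows "retract P \<Lambda> \<zeta> = \<xi>"
  by (simp add: retract_def assms(3) pseudo_inverse_left_inverse[OF inj_Emat[OF assms(1,2)]])

lemma agree_upto_Emat:
  assumes "valid_lifting P \<Lambda>" and "agree_upto (obs_stage P) t \<xi> \<eta>"
  shows "agree_upto (theta_stage \<Lambda>) t (Emat \<Lambda> *v \<xi>) (Emat \<Lambda> *v \<eta>)"
  unfolding agree_upto_def
proof (intro allI impI)
  fix i
  assume i: "theta_stage \<Lambda> i \<le> t"
  have "Emat \<Lambda> $ i $ n * \<xi> $ n = Emat \<Lambda> $ i $ n * \<eta> $ n" for n
  proof (cases "obs_stage P n \<le> t")
    case False
    then have "Emat \<Lambda> $ i $ n = 0"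
      using assms(1) i unfolding valid_lifting_def by (meson le_less_trans not_le)
    then show ?thesis
      by simp
  qed (use assms(2) in \<open>simp add: agree_upto_def\<close>)
  then show "(Emat \<Lambda> *v \<xi>) $ i = (Emat \<Lambda> *v \<eta>) $ i"
    unfolding matrix_vector_mult_def vec_lambda_beta by (intro sum.cong refl)
qed

text \<open>
  Both transfers produce a rule whose values are values of the given rule; this is what carries the
  here-and-now decisions over unchanged.
\<close>

lemma lift_aff_feasible:
  fixes P :: "('n::finite, 'd::finite, 'm::finite) problem"
    and \<Lambda> :: "('n, 'i::finite, 'k::finite) lifting"
  assumes valid: "valid_lifting P \<Lambda>" and stages: "range (obs_stage P) \<subseteq> {1..horizon P}"
    and x: "x \<in> aff_feasible P"
  obtains x' where "x' \<in> lifted_aff_feasible P \<Lambda> (outer_approx P \<Lambda>)" and "range x' \<subseteq> range x"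
proof -
  obtain H where H: "linear H" "\<And>\<xi>. H (Emat \<Lambda> *v \<xi>) = \<xi>"
      "\<And>t \<theta> \<eta>. agree_upto (theta_stage \<Lambda>) t \<theta> \<eta> \<Longrightarrow> agree_upto (obs_stage P) t (H \<theta>) (H \<eta>)"
    using nonanticipative_left_inverse[OF valid stages] by blast
  define x' where "x' \<zeta> = x (H (unfolding_map P \<Lambda> \<zeta>))" for \<zeta>
  have "x' \<in> lifted_rules P \<Lambda>"
    unfolding lifted_rules_def
  proof (intro CollectI allI impI)
    fix k and \<zeta> \<eta> :: "real^'k"
    assume "\<forall>i. theta_stage \<Lambda> i \<le> dec_stage P k \<longrightarrow>
      (\<forall>j\<in>{1..pieces \<Lambda> i}. \<zeta> $ slot \<Lambda> i j = \<eta> $ slot \<Lambda> i j)"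
    then have "agree_upto (theta_stage \<Lambda>) (dec_stage P k)
        (unfolding_map P \<Lambda> \<zeta>) (unfolding_map P \<Lambda> \<eta>)"
      by (auto simp: agree_upto_def unfolding_map_def intro!: sum.cong)
    then show "x' \<zeta> $ k = x' \<eta> $ k"
      using H(3) x unfolding x'_def aff_feasible_def rules_def by blast
  qed
  moreover have "affine_map x'"
    unfolding x'_def using x
    by (intro affine_map_compose[OF _ affine_map_compose[OF linear_imp_affine_map[OF H(1)]
          affine_map_unfolding]])
      (auto simp: aff_feasible_def)
  moreover have "Amat P g *v x' \<zeta> \<le> rhs P g (retract P \<Lambda> \<zeta>)"
    if g: "g \<in> {1..num_sets P}" and \<zeta>: "\<zeta> \<in> outer_approx P \<Lambda> g" for g \<zeta>
  proof -
    obtain \<xi> where \<xi>: "\<xi> \<in> Xi P g" "unfolding_map P \<Lambda> \<zeta> = Emat \<Lambda> *v \<xi>"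
      using \<zeta> by (auto simp: outer_approx_def Theta_def)
    then show ?thesis
      using x g by (simp add: x'_def H(2) retract_eq[OF valid stages \<xi>(2)] aff_feasible_def)
  qed
  ultimately show ?thesis
    by (intro that[of x']) (auto simp: lifted_aff_feasible_def x'_def)
qed

lemma unlift_aff_feasible:
  assumes valid: "valid_lifting P \<Lambda>" and stages: "range (obs_stage P) \<subseteq> {1..horizon P}"
    and one: "num_sets P = 1" and cpt: "compact (Xi P 1)"
    and x': "x' \<in> lifted_aff_feasible P \<Lambda> (outer_approx P \<Lambda>)"
  obtains x where "x \<in> aff_feasible P" and "range x \<subseteq> range x'"
proof -
  define l u where "l = lower_corner (Theta_all P \<Lambda>)" and "u = upper_corner (Theta_all P \<Lambda>)"
  have Theta_all: "Theta_all P \<Lambda> = Theta P \<Lambda> 1"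
    by (simp add: Theta_all_def one)
  have "compact (Theta_all P \<Lambda>)"
    unfolding Theta_all Theta_def using cpt
    by (intro compact_continuous_image matrix_vector_mult_linear_continuous_on)
  note corners = compact_imp_between_corners[OF this, folded l_def u_def]
  \<comment> \<open>If the box is degenerate in coordinate \<open>i\<close>, division by zero makes the relative coordinate 0,
    which is a correct value for the only point of that side.\<close>
  define rel where "rel \<theta> = (\<chi> i. (\<theta> $ i - l $ i) / (u $ i - l $ i))" for \<theta>
  have "affine_map rel"
    unfolding affine_map_def
  proof (intro exI conjI allI)
    show "linear (\<lambda>\<theta>. \<chi> i. \<theta> $ i / (u $ i - l $ i))"
      by (rule linearI) (auto simp: vec_eq_iff add_divide_distrib)
    show "rel \<theta> = (\<chi> i. \<theta> $ i / (u $ i - l $ i)) + (\<chi> i. - l $ i / (u $ i - l $ i))" for \<theta>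
      by (simp add: rel_def vec_eq_iff diff_divide_distrib)
  qed
  define x where "x \<xi> = x' (chord \<Lambda> (rel (Emat \<Lambda> *v \<xi>)))" for \<xi>
  have "x \<in> rules P"
    unfolding rules_def
  proof (intro CollectI allI impI)
    fix k \<xi> \<eta>
    assume "agree_upto (obs_stage P) (dec_stage P k) \<xi> \<eta>"
    from agree_upto_Emat[OF valid this]
    have "\<forall>i. theta_stage \<Lambda> i \<le> dec_stage P k \<longrightarrow> (\<forall>j\<in>{1..pieces \<Lambda> i}.
        chord \<Lambda> (rel (Emat \<Lambda> *v \<xi>)) $ slot \<Lambda> i j = chord \<Lambda> (rel (Emat \<Lambda> *v \<eta>)) $ slot \<Lambda> i j)"
      using chord_nth[OF valid] by (simp add: rel_def agree_upto_def)
    then show "x \<xi> $ k = x \<eta> $ k"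
      using x' unfolding x_def lifted_aff_feasible_def lifted_rules_def by blast
  qed
  moreover have "affine_map x"
    unfolding x_def using x' \<open>affine_map rel\<close>
    by (intro affine_map_compose[OF _ affine_map_compose[OF linear_imp_affine_map[OF linear_chord]
          affine_map_compose[OF _ linear_imp_affine_map[OF matrix_vector_mul_linear]]]])
      (auto simp: lifted_aff_feasible_def)
  moreover have "Amat P g *v x \<xi> \<le> rhs P g \<xi>" if g: "g \<in> {1..num_sets P}" and \<xi>: "\<xi> \<in> Xi P g" for g \<xi>
  proof -
    let ?\<theta> = "Emat \<Lambda> *v \<xi>" and ?\<zeta> = "chord \<Lambda> (rel (Emat \<Lambda> *v \<xi>))"
    have g1: "g = 1"
      using g one by simp
    then have \<theta>: "?\<theta> \<in> Theta_all P \<Lambda>"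
      using \<xi> by (simp add: Theta_all Theta_def)
    have le: "l $ i \<le> u $ i" for i
      using corners[OF \<theta>] order_trans by blast
    have "l $ i + rel ?\<theta> $ i * (u $ i - l $ i) = ?\<theta> $ i" for i
      using corners(1)[OF \<theta>, of i] corners(2)[OF \<theta>, of i]
      by (cases "u $ i = l $ i") (auto simp: rel_def)
    then have unfold: "unfolding_map P \<Lambda> ?\<zeta> = ?\<theta>"
      by (simp add: unfolding_chord[OF valid, folded l_def u_def] vec_eq_iff)
    have "rel ?\<theta> $ i \<in> {0..1}" for i
      using corners(1)[OF \<theta>, of i] corners(2)[OF \<theta>, of i] le[of i]
      by (simp add: rel_def divide_le_eq)
    then have "rel ?\<theta> \<bullet> e \<in> {0..1}" if "e \<in> Basis" for e
      using that by (auto simp: Basis_vec_def inner_axis)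
    then have "rel ?\<theta> \<in> cbox 0 One"
      by (simp add: mem_box)
    then have "?\<zeta> \<in> outer_approx P \<Lambda> g"
      using chord_in_convex_hull_folding[OF valid _ le[unfolded l_def u_def]] \<theta> unfold
      by (simp add: outer_approx_def g1 Theta_all)
    then have "Amat P g *v x' ?\<zeta> \<le> rhs P g (retract P \<Lambda> ?\<zeta>)"
      using x' g unfolding lifted_aff_feasible_def by blast
    then show ?thesis
      by (simp add: x_def retract_eq[OF valid stages unfold])
  qed
  ultimately show ?thesis
    by (intro that[of x]) (auto simp: aff_feasible_def x_def)
qed

section \<open>Objective values of robust instances\<close>

lemma scaleR_axis_one: "r *\<^sub>R axis s 1 = (axis s r :: real^'k)"
  by (auto simp: axis_def vec_eq_iff)

lemma measurable_lift:
  fixes P :: "('n::finite, 'd::finite, 'm::finite) problem"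
    and \<Lambda> :: "('n, 'i::finite, 'k::finite) lifting"
  assumes "valid_lifting P \<Lambda>"
  shows "lift \<Lambda> \<in> borel_measurable borel"
proof -
  have cont_axis: "continuous_on UNIV (\<lambda>\<xi>. axis s (f \<xi>) :: real^'k)"
    if "continuous_on UNIV f" for s and f :: "real^'n \<Rightarrow> real"
  proof -
    have "continuous_on UNIV (\<lambda>\<xi>. f \<xi> *\<^sub>R (axis s 1 :: real^'k))"
      using that by (intro continuous_intros)
    then show ?thesis
      by (simp add: scaleR_axis_one)
  qed
  have "continuous_on UNIV (\<lambda>\<xi>. \<Sum>i\<in>UNIV. \<Sum>j = 1..pieces \<Lambda> i. axis (slot \<Lambda> i j)
    (min (max ((Emat \<Lambda> *v \<xi>) $ i) (breakpoint \<Lambda> i (j - 1))) (breakpoint \<Lambda> i j)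
      - breakpoint \<Lambda> i (j - 1)))"
    by (intro continuous_on_sum cont_axis continuous_intros matrix_vector_mult_linear_continuous_on)
  also have "(\<lambda>\<xi>. \<Sum>i\<in>UNIV. \<Sum>j = 1..pieces \<Lambda> i. axis (slot \<Lambda> i j)
    (min (max ((Emat \<Lambda> *v \<xi>) $ i) (breakpoint \<Lambda> i (j - 1))) (breakpoint \<Lambda> i j)
      - breakpoint \<Lambda> i (j - 1))) = lift \<Lambda>"
    unfolding lift_def folding_def
    by (intro ext sum.cong refl, subst fold_component_eq[OF breakpoint_less[OF assms]]) auto
  finally show ?thesis
    by (rule borel_measurable_continuous_onI)
qed

context
  fixes T :: nat
    and \<sigma> :: "'n::finite \<Rightarrow> nat"
    and \<rho> :: "'d::finite \<Rightarrow> nat"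
    and \<Psi> :: "(real^'n) set"
    and M :: "(real^'n) measure"
    and c :: "real^'d"
    and A :: "real^'d^'m::finite"
    and b :: "real^'n \<Rightarrow> real^'m"
    and P :: "('n, 'd option, 'm option) problem"
  assumes \<sigma>: "range \<sigma> \<subseteq> {1..T}"
    and M: "prob_space M" "sets M = sets borel"
    and P: "P = robust_instance T \<sigma> \<rho> \<Psi> M c A b"
begin

lemma inner_cost_robust_instance: "cost P \<xi> \<bullet> v = v $ None"
  by (simp add: P robust_instance_def inner_axis')

lemma objective_robust_instance:
  assumes "x \<in> rules P"
  shows "objective P x = x \<eta> $ None"
proof -
  have "\<sigma> n \<noteq> 0" for n
    using \<sigma> by (metis atLeastAtMost_iff not_one_le_zero range_subsetD)
  then have "\<not> obs_stage P n \<le> dec_stage P None" for n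
    by (simp add: P robust_instance_def)
  then have "(\<lambda>\<xi>. x \<xi> $ None) = (\<lambda>\<xi>. x \<eta> $ None)"
    using assms unfolding rules_def agree_upto_def by blast
  moreover have "prob_space (Prob P)"
    using M(1) by (simp add: P robust_instance_def)
  ultimately show ?thesis
    by (simp add: objective_def inner_cost_robust_instance prob_space.prob_space)
qed

lemma lifted_objective_robust_instance:
  assumes valid: "valid_lifting P \<Lambda>" and "x' \<in> lifted_rules P \<Lambda>"
  shows "lifted_objective P \<Lambda> x' = x' \<eta> $ None"
proof -
  have "theta_stage \<Lambda> i \<noteq> 0" for i
    using valid unfolding valid_lifting_def by (metis atLeastAtMost_iff not_one_le_zero range_subsetD)
  then have "\<not> theta_stage \<Lambda> i \<le> dec_stage P None" for i
    by (simp add: P robust_instance_def)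
  then have "(\<lambda>\<zeta>. x' \<zeta> $ None) = (\<lambda>\<zeta>. x' \<eta> $ None)"
    using assms(2) unfolding lifted_rules_def by blast
  moreover have "lift \<Lambda> \<in> borel_measurable M"
    using measurable_lift[OF valid] measurable_cong_sets[OF M(2) refl] by blast
  then have "prob_space (lifted_Prob P \<Lambda>)"
    using M(1) by (simp add: lifted_Prob_def P robust_instance_def prob_space.prob_space_distr)
  ultimately show ?thesis
    by (simp add: lifted_objective_def inner_cost_robust_instance prob_space.prob_space)
qed

text \<open>
  A rule and its transfer share a value, hence the constant epigraphical component of that value.
\<close>

lemma robust_instance_same_objective_values:
  assumes cpt: "compact \<Psi>" and valid: "valid_lifting P \<Lambda>"
  shows "lifted_objective P \<Lambda> ` lifted_aff_feasible P \<Lambda> (outer_approx P \<Lambda>) =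
    objective P ` aff_feasible P"
proof -
  have stages: "range (obs_stage P) \<subseteq> {1..horizon P}"
    using \<sigma> by (simp add: P robust_instance_def)
  have same: "objective P x = lifted_objective P \<Lambda> x'"
    if "x \<in> aff_feasible P" "x' \<in> lifted_aff_feasible P \<Lambda> (outer_approx P \<Lambda>)" "x \<xi> = x' \<zeta>" for x x' \<xi> \<zeta>
    using objective_robust_instance[of x \<xi>] lifted_objective_robust_instance[OF valid, of x' \<zeta>] that
    by (simp add: aff_feasible_def lifted_aff_feasible_def)
  show ?thesis
  proof (intro equalityI subsetI; elim imageE; hypsubst)
    fix x'
    assume x': "x' \<in> lifted_aff_feasible P \<Lambda> (outer_approx P \<Lambda>)"
    have "num_sets P = 1" "compact (Xi P 1)"
      using cpt by (simp_all add: P robust_instance_def)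
    then obtain x where x: "x \<in> aff_feasible P" "range x \<subseteq> range x'"
      using unlift_aff_feasible[OF valid stages _ _ x'] by blast
    then show "lifted_objective P \<Lambda> x' \<in> objective P ` aff_feasible P"
      using same[OF x(1) x', of 0] by (metis imageI rangeE range_subsetD)
  next
    fix x
    assume x: "x \<in> aff_feasible P"
    then obtain x' where x': "x' \<in> lifted_aff_feasible P \<Lambda> (outer_approx P \<Lambda>)" "range x' \<subseteq> range x"
      using lift_aff_feasible[OF valid stages x] by blast
    then show "objective P x \<in> lifted_objective P \<Lambda> ` lifted_aff_feasible P \<Lambda> (outer_approx P \<Lambda>)"
      using same[OF x x'(1), of _ 0] by (metis imageI rangeE range_subsetD)
  qed
qed

end

lemma ex_is_arg_min_iff_image:
  "(\<exists>x. is_arg_min f (\<lambda>x. x \<in> S) x) \<longleftrightarrow> (\<exists>v\<in>f ` S. \<forall>w\<in>f ` S. \<not> w < v)"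
  by (auto simp: is_arg_min_def)

theorem corollary1:
  fixes T :: nat
    and \<sigma> :: "'n::finite \<Rightarrow> nat"
    and \<rho> :: "'d::finite \<Rightarrow> nat"
    and \<Psi> :: "(real^'n) set"
    and M :: "(real^'n) measure"
    and c :: "real^'d"
    and A :: "real^'d^'m::finite"
    and b :: "real^'n \<Rightarrow> real^'m"
    and \<Lambda> :: "('n, 'i::finite, 'k::finite) lifting"
    and P :: "('n, 'd option, 'm option) problem"
  assumes "range \<sigma> \<subseteq> {1..T}"
    and "range \<rho> \<subseteq> {0..T}"
    and "compact \<Psi>"
    and "prob_space M"
    and "sets M = sets borel"
    and "measure M \<Psi> = 1"
    and "affine_map b"
    and "P = robust_instance T \<sigma> \<rho> \<Psi> M c A b"
    and "valid_lifting P \<Lambda>"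
  shows "lifted_aff_value P \<Lambda> (outer_approx P \<Lambda>) = aff_value P \<and>
    ((\<exists>x'. is_arg_min (lifted_objective P \<Lambda>) (\<lambda>x'. x' \<in> lifted_aff_feasible P \<Lambda> (outer_approx P \<Lambda>)) x')
      \<longleftrightarrow> (\<exists>x. is_arg_min (objective P) (\<lambda>x. x \<in> aff_feasible P) x))"
proof -
  have same: "lifted_objective P \<Lambda> ` lifted_aff_feasible P \<Lambda> (outer_approx P \<Lambda>) =
      objective P ` aff_feasible P"
    using assms by (intro robust_instance_same_objective_values)
  then have "ereal ` lifted_objective P \<Lambda> ` lifted_aff_feasible P \<Lambda> (outer_approx P \<Lambda>) =
      ereal ` objective P ` aff_feasible P"
    by simp
  then have "lifted_aff_value P \<Lambda> (outer_approx P \<Lambda>) = aff_value P"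
    by (simp add: lifted_aff_value_def aff_value_def image_image)
  then show ?thesis
    by (simp add: ex_is_arg_min_iff_image same)
qed

end
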